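(* For an integer $n\ge 1$ let $s_2(n)$ denote the sum of the binary digits of $n$ and let $\varepsilon_n=(-1)^{s_2(n)}$. Let $\mathcal O=\{n\ge 1: s_2(n)\text{ odd}\}$ (the odious numbers) and $\mathcal E=\{n\ge 1: s_2(n)\text{ even}\}$ (the evil numbers). Set $$Q=\prod_{n\ge 1}\left(\frac{2n}{2n+1}\right)^{\varepsilon_n}.$$ Then the zeta-regularized products of the odious and of the evil numbers exist and satisfy $$\operatorname*{\widehat{\prod}}_{n\in\mathcal O} n=(2\pi)^{1/4}Q^{-1/2},\qquad \operatorname*{\widehat{\prod}}_{n\in\mathcal E} n=(2\pi)^{1/4}Q^{1/2}.$$ Moreover $Q=\dfrac{2^{-1/2}e^{\gamma}}{\varphi}$, where $\gamma$ is the Euler–Mascheroni constant and $\varphi$ is the Flajolet–Martin constant. In particular $\operatorname*{\widehat{\prod}}_{n\in\mathcal O} n=\pi^{1/4}\sqrt{2\varphi e^{-\gamma}}$.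
   Context: Zeta-regularized product: for a set (or sequence) $\Lambda$ of positive reals $\lambda_i$, let $\zeta_\Lambda(s)=\sum_i \lambda_i^{-s}$. If this Dirichlet series converges for $\Re s$ large enough, admits a meromorphic continuation to the whole complex plane, and has no pole at $s=0$, then the zeta-regularized product is defined as $\operatorname*{\widehat{\prod}}_{i}\lambda_i:=e^{-\zeta_\Lambda'(0)}$. The infinite product defining $Q$ is understood as the limit of its partial products. The Flajolet–Martin constant is $\varphi:=2^{-1/2}e^{\gamma}\,\frac{2}{3}\prod_{n\ge 1}\left(\frac{(4n+1)(4n+2)}{4n(4n+3)}\right)^{\varepsilon_n}=0.77351\ldots$. *)

theory Defs
  imports "HOL-Complex_Analysis.Complex_Analysis"
begin

text \<open>
  The numbers form a family \<open>(\<lambda>\<^sub>i)\<^sub>i\<^sub>\<in>\<^sub>I\<close> of positive reals, which covers both sets and sequences.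
  The terms are positive for real \<open>s\<close>, so convergence of the Dirichlet series for all \<open>s\<close> with large
  real part is the same as unconditional convergence there.  Requiring the continuation to be
  \<^emph>\<open>nicely\<close> meromorphic (continuous away from its poles, value \<open>0\<close> at the poles) excludes arbitrary
  values at isolated points and makes the continuation unique as a function.
\<close>

definition zeta_continuation :: "'i set \<Rightarrow> ('i \<Rightarrow> real) \<Rightarrow> (complex \<Rightarrow> complex) \<Rightarrow> bool" where
  "zeta_continuation I lam Z \<longleftrightarrow>
     Z nicely_meromorphic_on UNIV \<and>
     (\<exists>c::real. \<forall>s. Re s > c \<longrightarrow> ((\<lambda>i. complex_of_real (lam i) powr (- s)) has_sum Z s) I)"

definition zeta_regularizable :: "'i set \<Rightarrow> ('i \<Rightarrow> real) \<Rightarrow> bool" where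
  "zeta_regularizable I lam \<longleftrightarrow>
     (\<forall>i\<in>I. lam i > 0) \<and> (\<exists>Z. zeta_continuation I lam Z \<and> \<not> is_pole Z 0)"

definition zeta_reg_prod :: "'i set \<Rightarrow> ('i \<Rightarrow> real) \<Rightarrow> complex" where
  "zeta_reg_prod I lam = exp (- deriv (THE Z. zeta_continuation I lam Z) 0)"

lemma zeta_continuation_unique:
  assumes "zeta_continuation I lam Z1" and "zeta_continuation I lam Z2"
  shows "Z1 = Z2"
proof -
  from assms obtain c1 c2 where
    n1: "Z1 nicely_meromorphic_on UNIV" and n2: "Z2 nicely_meromorphic_on UNIV" and
    c1: "\<And>s. Re s > c1 \<Longrightarrow> ((\<lambda>i. complex_of_real (lam i) powr (- s)) has_sum Z1 s) I" and
    c2: "\<And>s. Re s > c2 \<Longrightarrow> ((\<lambda>i. complex_of_real (lam i) powr (- s)) has_sum Z2 s) I"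
    unfolding zeta_continuation_def by blast
  define U where "U = {s. Re s > max c1 c2}"
  have U: "open U" unfolding U_def by (rule open_halfspace_Re_gt)
  have eqU: "Z1 s = Z2 s" if "s \<in> U" for s
    using c1[of s] c2[of s] that by (auto simp: U_def intro: has_sum_unique)
  have rs: "remove_sings Z = Z" if n: "Z nicely_meromorphic_on UNIV" for Z
  proof
    fix z
    from n have "(is_pole Z z \<and> Z z = 0) \<or> Z \<midarrow>z\<rightarrow> Z z"
      by (auto simp: nicely_meromorphic_on_def)
    thus "remove_sings Z z = Z z" by auto
  qed
  define D where "D = (\<lambda>s. Z1 s - Z2 s)"
  have mD: "D meromorphic_on UNIV"
    using n1 n2 unfolding D_def nicely_meromorphic_on_def
    by (intro meromorphic_on_diff) auto
  define s0 where "s0 = complex_of_real (max c1 c2 + 1)"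
  have s0: "s0 \<in> U" by (simp add: U_def s0_def max_def)
  have ev0: "eventually (\<lambda>z. D z = 0) (at s0)"
    using eventually_at_in_open'[OF U s0] by eventually_elim (simp add: D_def eqU)
  have "eventually (\<lambda>z. D z = 0) (cosparse UNIV) \<or> eventually (\<lambda>z. D z \<noteq> 0) (cosparse UNIV)"
    by (rule meromorphic_imp_constant_or_avoid[OF mD]) auto
  moreover have False if "eventually (\<lambda>z. D z \<noteq> 0) (cosparse UNIV)"
  proof -
    have "eventually (\<lambda>z. D z \<noteq> 0) (at s0)"
      using that by (auto simp: eventually_cosparse_open_eq)
    with ev0 have "eventually (\<lambda>z. False) (at s0)" by eventually_elim auto
    thus False by simp
  qed
  ultimately have ev: "eventually (\<lambda>z. Z1 z = Z2 z) (at z)" for z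
    by (auto simp: eventually_cosparse_open_eq D_def)
  show ?thesis
  proof
    fix z
    from ev[of z] have "remove_sings Z1 z = remove_sings Z2 z"
      by (intro remove_sings_cong) auto
    thus "Z1 z = Z2 z" by (simp add: rs n1 n2)
  qed
qed

lemma zeta_reg_prod_eqI:
  assumes "zeta_continuation I lam Z"
  shows "zeta_reg_prod I lam = exp (- deriv Z 0)"
  unfolding zeta_reg_prod_def
  using assms zeta_continuation_unique by (metis the_equality)


fun s2 :: "nat \<Rightarrow> nat" where
  "s2 n = (if n = 0 then 0 else n mod 2 + s2 (n div 2))"

declare s2.simps [simp del]

definition eps :: "nat \<Rightarrow> int" where
  "eps n = (- 1) ^ s2 n"

definition odious :: "nat set" where
  "odious = {n. n \<ge> 1 \<and> odd (s2 n)}"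

definition evil :: "nat set" where
  "evil = {n. n \<ge> 1 \<and> even (s2 n)}"

definition Q_partial :: "nat \<Rightarrow> real" where
  "Q_partial N = (\<Prod>n=1..N. (2 * real n / (2 * real n + 1)) powi eps n)"

definition Q :: real where
  "Q = lim Q_partial"

definition FM_partial :: "nat \<Rightarrow> real" where
  "FM_partial N =
     (\<Prod>n=1..N. ((4 * real n + 1) * (4 * real n + 2) / (4 * real n * (4 * real n + 3))) powi eps n)"

definition flajolet_martin :: real where
  "flajolet_martin = 2 powr (- 1 / 2) * exp euler_mascheroni * (2 / 3) * lim FM_partial"

end

theory Submission
  imports Defs
begin

text \<open>
  For \<open>Re s > 1\<close> the series over the odious and the evil numbers are \<open>(\<zeta>(s) \<mp> D(s)) / 2\<close>, where
  \<open>D(s) = \<Sum>\<epsilon>\<^sub>n n\<^sup>-\<^sup>s\<close>.  Splitting \<open>D\<close> into even and odd \<open>n\<close> and using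
  \<open>\<epsilon>\<^sub>2\<^sub>n = \<epsilon>\<^sub>n = - \<epsilon>\<^sub>2\<^sub>n\<^sub>+\<^sub>1\<close> replaces \<open>x\<^sup>-\<^sup>s\<close> by its difference with step \<open>1/2\<close>.  An \<open>r\<close>-fold difference is
  \<open>O(x\<^sup>-\<^sup>s\<^sup>-\<^sup>r)\<close>, so iterating the splitting makes \<open>D\<close> entire, and two steps already
  give \<open>D'(0) = - ln Q\<close> by termwise differentiation.  Averaging does the same for
  \<open>\<eta>(s) = \<Sum>(-1)\<^sup>n\<^sup>-\<^sup>1 n\<^sup>-\<^sup>s\<close>, and Wallis' product gives \<open>\<eta>'(0) = ln (\<pi>/2) / 2\<close>.  Then
  \<open>\<zeta>(s) = \<eta>(s) / (1 - 2\<^sup>1\<^sup>-\<^sup>s)\<close> is meromorphic with \<open>\<zeta>'(0) = - ln (2\<pi>) / 2\<close>; that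
  the zeros of the denominator other than \<open>s = 1\<close> are not poles is irrelevant here.
\<close>

subsection \<open>Differences of powers and Dirichlet series with bounded coefficients\<close>

text \<open>The steps form a list because splitting by parity halves all earlier ones: the
  Thue--Morse series leads to steps 1/2, 1/4, ..., the alternating series to steps 1, 1,
  ....\<close>

primrec powr_diff :: "real list \<Rightarrow> complex \<Rightarrow> real \<Rightarrow> complex" where
  "powr_diff [] s x = of_real x powr (- s)"
| "powr_diff (h # hs) s x = powr_diff hs s x - powr_diff hs s (x + h)"

text \<open>Coefficients are indexed by the integer n itself; the shift by \<open>Suc\<close> starts
  the sum at n = 1, where the argument of the power is positive.\<close>

definition diff_series :: "(nat \<Rightarrow> complex) \<Rightarrow> real list \<Rightarrow> complex \<Rightarrow> complex" where
  "diff_series a hs s = (\<Sum>n. a (Suc n) * powr_diff hs s (real (Suc n)))"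

lemma holomorphic_powr_diff [holomorphic_intros]:
  assumes "x > 0" "\<And>h. h \<in> set hs \<Longrightarrow> h \<ge> 0"
  shows "(\<lambda>s. powr_diff hs s x) holomorphic_on A"
  using assms
proof (induction hs arbitrary: x)
  case Nil
  then show ?case by (auto intro!: holomorphic_intros)
next
  case (Cons h hs)
  from Cons.prems(2)[of h] Cons.prems(1) have "x + h > 0" by simp
  with Cons show ?case by (auto intro!: holomorphic_intros)
qed

text \<open>Differentiation in \<open>x\<close> commutes with differencing, so it only replaces s by
  s + 1 and adds a factor -s. This drives the induction for the size estimate.\<close>

lemma has_vector_derivative_powr_diff:
  assumes "x > 0" "\<And>h. h \<in> set hs \<Longrightarrow> h \<ge> 0"
  shows "(powr_diff hs s has_vector_derivative (- s * powr_diff hs (s + 1) x)) (at x)"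
  using assms
proof (induction hs arbitrary: x)
  case Nil
  have "((\<lambda>z. z powr (- s)) has_field_derivative (- s * of_real x powr (- s - 1))) (at (of_real x))"
    using Nil by (intro has_field_derivative_powr) (auto simp: complex_nonpos_Reals_iff)
  then have "((\<lambda>y. of_real y powr (- s)) has_vector_derivative (- s * of_real x powr (- s - 1))) (at x)"
    by (rule has_vector_derivative_real_field)
  moreover have "- s - 1 = - (s + 1)" by simp
  moreover have "powr_diff [] s = (\<lambda>y. of_real y powr (- s))" by auto
  ultimately show ?case by (simp only: powr_diff.simps)
next
  case (Cons h hs)
  from Cons.prems(2)[of h] Cons.prems(1) have xh: "x + h > 0" by simp
  have "((\<lambda>y. powr_diff hs s (y + h)) has_vector_derivative (- s * powr_diff hs (s + 1) (x + h))) (at x)"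
  proof -
    have "((\<lambda>y. y + h) has_vector_derivative 1) (at x)"
      by (auto intro!: derivative_eq_intros)
    moreover have "(powr_diff hs s has_vector_derivative (- s * powr_diff hs (s + 1) (x + h))) (at (x + h))"
      using Cons.IH[OF xh] Cons.prems by simp
    ultimately show ?thesis
      using vector_diff_chain_at[of "\<lambda>y. y + h" 1 x "powr_diff hs s"] by (simp add: o_def)
  qed
  moreover have "(powr_diff hs s has_vector_derivative (- s * powr_diff hs (s + 1) x)) (at x)"
    using Cons by simp
  ultimately have "((\<lambda>y. powr_diff hs s y - powr_diff hs s (y + h)) has_vector_derivative
      (- s * powr_diff hs (s + 1) x - (- s * powr_diff hs (s + 1) (x + h)))) (at x)"
    by (intro has_vector_derivative_diff)
  moreover have "powr_diff (h # hs) s = (\<lambda>y. powr_diff hs s y - powr_diff hs s (y + h))"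
    by auto
  ultimately show ?case by (simp add: algebra_simps)
qed

text \<open>By the mean value inequality, each difference costs a factor h and one derivative, that
  is, a factor s and the shift s -> s + 1; the factors s (s + 1) ... collect into the Pochhammer
  symbol. The bound on \<open>Re s\<close> makes the power of x nonincreasing, so its value at the
  left end dominates.\<close>

lemma norm_powr_diff_le:
  assumes "x > 0" "\<And>h. h \<in> set hs \<Longrightarrow> h \<ge> 0" "Re s + real (length hs) \<ge> 0"
  shows "norm (powr_diff hs s x) \<le>
           norm (pochhammer s (length hs)) * prod_list hs * x powr (- Re s - real (length hs))"
  using assms
proof (induction hs arbitrary: s x)
  case Nil
  then show ?case by (simp add: norm_powr_real_powr)
next
  case (Cons h hs)
  define r where "r = length hs"
  define C where "C = norm (pochhammer (s + 1) r) * prod_list hs"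
  have C: "C \<ge> 0" using Cons.prems(2) unfolding C_def
    by (intro mult_nonneg_nonneg prod_list_nonneg) auto
  have h: "h \<ge> 0" and hs: "\<And>h. h \<in> set hs \<Longrightarrow> h \<ge> 0" using Cons.prems by auto
  have main: "norm (powr_diff hs s (x + h) - powr_diff hs s x) \<le>
      norm s * (C * x powr (- Re s - Suc r)) * h"
  proof (cases "h = 0")
    case False
    with h have "h > 0" by simp
    have "\<exists>y\<in>{x<..<x+h}. norm (powr_diff hs s (x + h) - powr_diff hs s x)
        \<le> norm ((x + h - x) *\<^sub>R (- s * powr_diff hs (s + 1) y))"
    proof (rule mvt_general)
      show "continuous_on {x..x+h} (powr_diff hs s)"
        using Cons.prems(1) hs
        by (auto intro!: continuous_at_imp_continuous_on has_vector_derivative_continuous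
              has_vector_derivative_powr_diff)
    qed (use \<open>h > 0\<close> Cons.prems(1) hs has_vector_derivative_powr_diff[of _ hs s] in
          \<open>auto simp: has_vector_derivative_def\<close>)
    then obtain y where y: "x < y" "y < x + h"
      and le: "norm (powr_diff hs s (x + h) - powr_diff hs s x)
        \<le> norm ((x + h - x) *\<^sub>R (- s * powr_diff hs (s + 1) y))" by auto
    note le
    also have "norm ((x + h - x) *\<^sub>R (- s * powr_diff hs (s + 1) y)) =
        norm s * norm (powr_diff hs (s + 1) y) * h"
      using h by (simp add: norm_mult)
    also have "\<dots> \<le> norm s * (C * x powr (- Re s - Suc r)) * h"
    proof (intro mult_left_mono mult_right_mono h)
      have "norm (powr_diff hs (s + 1) y) \<le> C * y powr (- Re (s + 1) - real (length hs))"
        unfolding C_def r_def using Cons.prems y by (intro Cons.IH) auto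
      also have "- Re (s + 1) - real (length hs) = - Re s - Suc r" by (simp add: r_def)
      also have "C * y powr (- Re s - Suc r) \<le> C * x powr (- Re s - Suc r)"
        using Cons.prems y by (intro mult_left_mono powr_mono2' C) (auto simp: r_def)
      finally show "norm (powr_diff hs (s + 1) y) \<le> C * x powr (- Re s - Suc r)" .
    qed auto
    finally show ?thesis .
  qed auto
  have "norm (powr_diff (h # hs) s x) \<le> norm s * (C * x powr (- Re s - Suc r)) * h"
    using main by (simp add: norm_minus_commute)
  also have "\<dots> = norm (pochhammer s (length (h # hs))) * prod_list (h # hs)
      * x powr (- Re s - real (length (h # hs)))"
    by (simp add: C_def r_def pochhammer_rec norm_mult)
  finally show ?case .
qed

text \<open>The Pochhammer factor in \<open>norm_powr_diff_le\<close> vanishes at s = 0 once there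
  is at least one step.\<close>

lemma powr_diff_0:
  assumes "x > 0" "\<And>h. h \<in> set hs \<Longrightarrow> h \<ge> 0" "hs \<noteq> []"
  shows "powr_diff hs 0 x = 0"
  using norm_powr_diff_le[of x hs 0] assms by (simp add: pochhammer_0_left)

text \<open>Homogeneity of x^(-s). It turns differences at 2n back into differences at n with
  smaller steps.\<close>

lemma powr_diff_double:
  assumes "x > 0" "\<And>h. h \<in> set hs \<Longrightarrow> h \<ge> 0"
  shows "powr_diff hs s (2 * x) = 2 powr (- s) * powr_diff (map (\<lambda>h. h / 2) hs) s x"
  using assms
proof (induction hs arbitrary: x)
  case Nil
  then show ?case by (simp add: powr_times_real)
next
  case (Cons h hs)
  from Cons.prems(2)[of h] Cons.prems(1) have "x + h / 2 > 0" by simp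
  then have "powr_diff hs s (2 * (x + h / 2)) = 2 powr (- s) * powr_diff (map (\<lambda>h. h / 2) hs) s (x + h / 2)"
    using Cons.prems by (intro Cons.IH) auto
  moreover have "2 * (x + h / 2) = 2 * x + h" by simp
  ultimately have "powr_diff hs s (2 * x + h) = 2 powr (- s) * powr_diff (map (\<lambda>h. h / 2) hs) s (x + h / 2)"
    by metis
  moreover have "powr_diff hs s (2 * x) = 2 powr (- s) * powr_diff (map (\<lambda>h. h / 2) hs) s x"
    using Cons.prems by (intro Cons.IH) auto
  ultimately show ?case by (simp add: right_diff_distrib)
qed

section \<open>Locally uniform convergence and termwise differentiation\<close>

text \<open>With r steps the terms decay like n^(-Re t - r). Taking for \<open>d\<close> half the
  distance from s to the line Re = 1 - r, the same \<open>d\<close> serves as radius and as margin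
  in the exponent; the Pochhammer factor is bounded by compactness of the closed ball.\<close>

lemma diff_series_local_bound:
  assumes "\<And>n. norm (a n) \<le> 1" "\<And>h. h \<in> set hs \<Longrightarrow> h \<ge> 0" "Re s > 1 - real (length hs)"
  obtains d C where "d > 0" "C \<ge> 0"
    "\<And>t n. t \<in> ball s d \<Longrightarrow>
       norm (a (Suc n) * powr_diff hs t (real (Suc n))) \<le> C * real (Suc n) powr (- 1 - d)"
proof -
  define r where "r = length hs"
  define d where "d = (Re s + r - 1) / 2"
  have d: "d > 0" using assms by (simp add: d_def r_def)
  have "compact ((\<lambda>t. pochhammer t r) ` cball s d)"
    by (intro compact_continuous_image continuous_intros) (auto simp: pochhammer_prod intro!: continuous_intros)
  then obtain B where B: "\<And>t. t \<in> cball s d \<Longrightarrow> norm (pochhammer t r) \<le> B"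
    by (meson bounded_iff compact_imp_bounded imageI)
  have "s \<in> cball s d" using d by simp
  then have B0: "B \<ge> 0" using B[of s] norm_ge_zero[of "pochhammer s r"] by linarith
  have P: "prod_list hs \<ge> 0" using assms(2) by (intro prod_list_nonneg) auto
  show ?thesis
  proof (rule that[of d "B * prod_list hs"])
    fix t n assume t: "t \<in> ball s d"
    have "\<bar>Re (s - t)\<bar> < d" using t abs_Re_le_cmod[of "s - t"] by (simp add: dist_norm)
    then have "Re s - Re t < d" unfolding minus_complex.sel by linarith
    moreover have "Re s + r = 1 + 2 * d" by (simp add: d_def field_simps)
    ultimately have Re: "Re t + r > 1 + d" by linarith
    have "norm (a (Suc n) * powr_diff hs t (real (Suc n))) \<le> 1 * norm (powr_diff hs t (real (Suc n)))"
      unfolding norm_mult by (intro mult_right_mono assms(1)) auto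
    also have "\<dots> \<le> norm (pochhammer t r) * prod_list hs * real (Suc n) powr (- Re t - r)"
      using norm_powr_diff_le[of "real (Suc n)" hs t] assms Re d by (simp add: r_def)
    also have "\<dots> \<le> B * prod_list hs * real (Suc n) powr (- 1 - d)"
      using B[of t] t P B0 Re by (intro mult_mono powr_mono mult_nonneg_nonneg) auto
    finally show "norm (a (Suc n) * powr_diff hs t (real (Suc n))) \<le>
        B * prod_list hs * real (Suc n) powr (- 1 - d)" .
  qed (use d B0 P in auto)
qed

lemma summable_Suc_powr:
  assumes "d > 0"
  shows "summable (\<lambda>n. real (Suc n) powr (- 1 - d))"
proof -
  have "summable (\<lambda>n. real n powr (- 1 - d))"
    unfolding summable_real_powr_iff using assms by linarith
  then show ?thesis unfolding summable_Suc_iff[of "\<lambda>n. real n powr (- 1 - d)"] .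
qed

lemma summable_norm_diff_series:
  assumes "\<And>n. norm (a n) \<le> 1" "\<And>h. h \<in> set hs \<Longrightarrow> h \<ge> 0" "Re s > 1 - real (length hs)"
  shows "summable (\<lambda>n. norm (a (Suc n) * powr_diff hs s (real (Suc n))))"
proof -
  obtain d C where d: "d > 0" and
    le: "\<And>t n. t \<in> ball s d \<Longrightarrow>
       norm (a (Suc n) * powr_diff hs t (real (Suc n))) \<le> C * real (Suc n) powr (- 1 - d)"
    using diff_series_local_bound[of a hs s, OF assms] by metis
  have "summable (\<lambda>n. C * real (Suc n) powr (- 1 - d))"
    by (intro summable_mult summable_Suc_powr d)
  then show ?thesis
    by (rule summable_comparison_test'[where N = 0]) (use le[of s] d in simp)
qed

lemma diff_series_sums:
  assumes "\<And>n. norm (a n) \<le> 1" "\<And>h. h \<in> set hs \<Longrightarrow> h \<ge> 0" "Re s > 1 - real (length hs)"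
  shows "(\<lambda>n. a (Suc n) * powr_diff hs s (real (Suc n))) sums diff_series a hs s"
  unfolding diff_series_def
  by (rule summable_sums[OF summable_norm_cancel[OF summable_norm_diff_series[OF assms]]])

text \<open>Besides holomorphy, the derivative is exhibited as the sum of the termwise derivatives;
  at 0 this will be a series of logarithms.\<close>

lemma diff_series_deriv:
  assumes a: "\<And>n. norm (a n) \<le> 1" and hs: "\<And>h. h \<in> set hs \<Longrightarrow> h \<ge> 0"
    and s0: "Re s0 > 1 - real (length hs)"
  obtains d where "(diff_series a hs has_field_derivative d) (at s0)"
    "(\<lambda>n. a (Suc n) * deriv (\<lambda>s. powr_diff hs s (real (Suc n))) s0) sums d"
proof -
  define U where "U = {s. Re s > 1 - real (length hs)}"
  have U: "open U" unfolding U_def by (rule open_halfspace_Re_gt)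
  have "\<exists>g g'. \<forall>s\<in>U. ((\<lambda>n. a (Suc n) * powr_diff hs s (real (Suc n))) sums g s)
      \<and> ((\<lambda>n. a (Suc n) * deriv (\<lambda>s. powr_diff hs s (real (Suc n))) s) sums g' s)
      \<and> (g has_field_derivative g' s) (at s)"
  proof (rule series_and_derivative_comparison_complex[OF U])
    fix n s
    show "((\<lambda>s. a (Suc n) * powr_diff hs s (real (Suc n))) has_field_derivative
        a (Suc n) * deriv (\<lambda>s. powr_diff hs s (real (Suc n))) s) (at s)"
      by (intro DERIV_cmult holomorphic_derivI[of _ UNIV] holomorphic_powr_diff hs) auto
  next
    fix s assume "s \<in> U"
    then obtain d C where d: "d > 0" and C: "C \<ge> 0" and
      le: "\<And>t n. t \<in> ball s d \<Longrightarrow>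
         norm (a (Suc n) * powr_diff hs t (real (Suc n))) \<le> C * real (Suc n) powr (- 1 - d)"
      using diff_series_local_bound[of a hs s] assms by (auto simp: U_def)
    \<comment> \<open>The comparison theorem takes its majorant as a complex series with nonnegative
      real terms.\<close>
    have "summable (\<lambda>n. complex_of_real (C * real (Suc n) powr (- 1 - d)))"
      by (intro summable_of_real summable_mult summable_Suc_powr d)
    then show "\<exists>d h. 0 < d \<and> summable h \<and> range h \<subseteq> \<real>\<^sub>\<ge>\<^sub>0 \<and> (\<forall>\<^sub>F n in sequentially.
        \<forall>t\<in>ball s d \<inter> U. norm (a (Suc n) * powr_diff hs t (real (Suc n))) \<le> norm (h n :: complex))"
      using d C le
      by (intro exI[of _ d] exI[of _ "\<lambda>n. complex_of_real (C * real (Suc n) powr (- 1 - d))"])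
         (auto simp: norm_mult)
  qed
  then obtain g g' where g: "\<And>s. s \<in> U \<Longrightarrow> (\<lambda>n. a (Suc n) * powr_diff hs s (real (Suc n))) sums g s"
    "\<And>s. s \<in> U \<Longrightarrow> (\<lambda>n. a (Suc n) * deriv (\<lambda>s. powr_diff hs s (real (Suc n))) s) sums g' s"
    "\<And>s. s \<in> U \<Longrightarrow> (g has_field_derivative g' s) (at s)" by blast
  have "(diff_series a hs has_field_derivative g' s) (at s)" if "s \<in> U" for s
    using g(3)[OF that] U that
    by (rule has_field_derivative_transform_within_open)
       (simp add: diff_series_def sums_unique[OF g(1)])
  then show ?thesis using g(2)[of s0] s0 by (intro that[of "g' s0"]) (auto simp: U_def)
qed

lemma holomorphic_diff_series:
  assumes "\<And>n. norm (a n) \<le> 1" "\<And>h. h \<in> set hs \<Longrightarrow> h \<ge> 0"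
  shows "diff_series a hs holomorphic_on {s. Re s > 1 - real (length hs)}"
  unfolding holomorphic_on_open[OF open_halfspace_Re_gt]
  using diff_series_deriv[of a hs, OF assms] by blast

section \<open>Continuation to the whole plane\<close>

text \<open>Identity theorem on a connected half-plane. It serves to glue continuations and to
  identify an entire function with an explicit formula left of the line of convergence.\<close>

lemma halfplane_identity:
  assumes "f holomorphic_on {s. Re s > c}" "g holomorphic_on {s. Re s > c}"
    "\<And>s. Re s > d \<Longrightarrow> f s = g s" "Re s > c"
  shows "f s = g s"
proof (rule analytic_continuation_open[of "{s. Re s > max c d}" "{s. Re s > c}" f g])
  have "of_real (max c d + 1) \<in> {s. Re s > max c d}" by (simp add: max_def)
  then show "{s. Re s > max c d} \<noteq> {}" by blast
  show "connected {s. Re s > c}" by (intro convex_connected convex_halfspace_Re_gt)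
  show "open {s. Re s > max c d}" "open {s. Re s > c}" by (rule open_halfspace_Re_gt)+
qed (use assms in auto)

text \<open>The assumption \<open>step\<close> abstracts both parity splitting and averaging: a
  series is traded for one with one more difference, which converges on a half-plane larger by a
  strip of width 1.\<close>

lemma diff_series_entire_continuation:
  fixes a :: "nat \<Rightarrow> complex"
  assumes a: "\<And>n. norm (a n) \<le> 1"
    and step: "\<And>hs. (\<And>h. h \<in> set hs \<Longrightarrow> h \<ge> 0) \<Longrightarrow>
      \<exists>hs' u v. (\<forall>h\<in>set hs'. h \<ge> 0) \<and> length hs' = Suc (length hs) \<and>
        u holomorphic_on UNIV \<and> v holomorphic_on UNIV \<and>
        (\<forall>s. Re s > 1 \<longrightarrow> diff_series a hs s = u s + v s * diff_series a hs' s)"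
  obtains F where "F holomorphic_on UNIV" "\<And>s. Re s > 1 \<Longrightarrow> F s = diff_series a [] s"
proof -
  \<comment> \<open>Here k counts the remaining steps; the list is generalized because every step
    replaces it by a longer one.\<close>
  have "\<exists>G. G holomorphic_on {s. Re s > 1 - real (length hs + k)} \<and>
      (\<forall>s. Re s > 1 \<longrightarrow> G s = diff_series a hs s)" if "\<forall>h\<in>set hs. h \<ge> 0" for k hs
    using that
  proof (induction k arbitrary: hs)
    case 0
    then show ?case using holomorphic_diff_series[of a hs] a by auto
  next
    case (Suc k)
    from step[of hs] Suc.prems obtain hs' u v where *: "\<forall>h\<in>set hs'. h \<ge> 0"
      "length hs' = Suc (length hs)" "u holomorphic_on UNIV" "v holomorphic_on UNIV"
      "\<And>s. Re s > 1 \<Longrightarrow> diff_series a hs s = u s + v s * diff_series a hs' s" by blast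
    from Suc.IH[OF *(1)] obtain G where G: "G holomorphic_on {s. Re s > 1 - real (length hs' + k)}"
      "\<And>s. Re s > 1 \<Longrightarrow> G s = diff_series a hs' s" by blast
    have "(\<lambda>s. u s + v s * G s) holomorphic_on {s. Re s > 1 - real (length hs + Suc k)}"
      using G(1) *(2) by (intro holomorphic_intros holomorphic_on_subset[OF *(3)]
        holomorphic_on_subset[OF *(4)] holomorphic_on_subset[OF G(1)]) auto
    then show ?case using G(2) *(5) by (intro exI[of _ "\<lambda>s. u s + v s * G s"]) simp
  qed
  from this[of "[]"] have "\<forall>k. \<exists>G. G holomorphic_on {s. Re s > 1 - real k} \<and>
      (\<forall>s. Re s > 1 \<longrightarrow> G s = diff_series a [] s)" by simp
  then obtain G where G: "\<And>k. G k holomorphic_on {s. Re s > 1 - real k}"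
    "\<And>k s. Re s > 1 \<Longrightarrow> G k s = diff_series a [] s" by metis
  \<comment> \<open>The index j chosen here satisfies 1 - j <= Re s - 1, so s lies in the domain of
    \<open>G j\<close>. It varies with s, but any two \<open>G k\<close> agree on their common
    half-plane.\<close>
  define F where "F s = G (nat \<lceil>2 - Re s\<rceil>) s" for s
  have F: "F s = G k s" if "Re s > 1 - real k" for s k
  proof -
    define j where "j = nat \<lceil>2 - Re s\<rceil>"
    have j: "Re s > 1 - real j" unfolding j_def by linarith
    have "G j s = G k s"
    proof (rule halfplane_identity[where c = "1 - real (min j k)" and d = 1 and s = s])
      show "G j holomorphic_on {s. Re s > 1 - real (min j k)}"
        by (rule holomorphic_on_subset[OF G(1)]) auto
      show "G k holomorphic_on {s. Re s > 1 - real (min j k)}"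
        by (rule holomorphic_on_subset[OF G(1)]) auto
    qed (use G(2) that j in \<open>auto simp: min_def\<close>)
    then show ?thesis by (simp add: F_def j_def)
  qed
  show ?thesis
  proof (rule that[of F])
    have "F field_differentiable at s" for s
    proof -
      obtain k :: nat where k: "real k > 1 - Re s" using reals_Archimedean2 by blast
      have "F holomorphic_on {s. Re s > 1 - real k}"
        using G(1)[of k] by (rule holomorphic_transform) (simp add: F)
      then show ?thesis using k
        by (intro holomorphic_on_imp_differentiable_at[of F "{s. Re s > 1 - real k}"])
           (auto intro: open_halfspace_Re_gt)
    qed
    then show "F holomorphic_on UNIV"
      by (simp add: holomorphic_on_def)
    show "F s = diff_series a [] s" if "Re s > 1" for s
      using F[of 0 s] G(2)[of s 0] that by simp
  qed
qed

subsection \<open>The Thue--Morse Dirichlet series\<close>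

lemma s2_double: "s2 (2 * n) = s2 n"
  by (cases "n = 0") (simp_all add: s2.simps[of "2 * n"])

lemma s2_double_Suc: "s2 (Suc (2 * n)) = Suc (s2 n)"
  by (simp add: s2.simps[of "Suc (2 * n)"])

lemma eps_double: "eps (2 * n) = eps n"
  by (simp add: eps_def s2_double)

lemma eps_double_Suc: "eps (Suc (2 * n)) = - eps n"
  by (simp add: eps_def s2_double_Suc)

lemma eps_cases: "eps n = 1 \<or> eps n = - 1"
  by (simp add: eps_def minus_one_power_iff)

lemma eps_0: "eps 0 = 1"
  by (simp add: eps_def s2.simps)

lemma eps_1: "eps (Suc 0) = - 1"
  using eps_double_Suc[of 0] by (simp add: eps_0)

lemma norm_eps_le: "norm (of_int (eps n) :: complex) \<le> 1"
  using eps_cases[of n] by auto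

lemma exp_eps_ln: "x > 0 \<Longrightarrow> exp (of_int (eps n) * ln x) = (x :: real) powi eps n"
  using eps_cases[of n] by (auto simp: exp_minus power_int_minus)

text \<open>The terms 2n and 2n + 1 have opposite signs \<epsilon>_n and -\<epsilon>_n, so together
  they form a difference with step 1 at 2n, which scales to step 1/2 at n. The incomplete first pair
  contributes only n = 1, where \<epsilon>_1 = -1.\<close>

lemma diff_series_eps:
  assumes hs: "\<And>h. h \<in> set hs \<Longrightarrow> h \<ge> 0" and s: "Re s > 1 - real (length hs)"
  shows "diff_series (\<lambda>n. of_int (eps n)) hs s = - powr_diff hs s 1 +
           2 powr (- s) * diff_series (\<lambda>n. of_int (eps n)) (1 / 2 # map (\<lambda>h. h / 2) hs) s"
proof -
  define D where "D = diff_series (\<lambda>n. of_int (eps n)) hs s"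
  define hs' where "hs' = 1 / 2 # map (\<lambda>h. h / 2) hs"
  \<comment> \<open>Padding with 0 at index 0 aligns the blocks of length two with the pairs {2n, 2n
    + 1}.\<close>
  define g where "g n = (if n = 0 then 0 else of_int (eps n) * powr_diff hs s (real n))" for n
  have "(\<lambda>n. g (Suc n)) sums D"
    using diff_series_sums[OF norm_eps_le hs s] by (simp add: g_def D_def)
  then have "g sums D"
    unfolding sums_Suc_iff by (simp add: g_def)
  then have "(\<lambda>n. sum g {n * 2..<n * 2 + 2}) sums D"
    by (rule sums_group) simp
  moreover have "sum g {n * 2..<n * 2 + 2} = g (2 * n) + g (Suc (2 * n))" for n
  proof -
    have "{n * 2..<n * 2 + 2} = {2 * n, Suc (2 * n)}" by auto
    then show ?thesis by simp
  qed
  ultimately have "(\<lambda>n. g (2 * n) + g (Suc (2 * n))) sums D" by simp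
  then have "(\<lambda>n. g (2 * Suc n) + g (Suc (2 * Suc n))) sums (D - (g (2 * 0) + g (Suc (2 * 0))))"
    by (subst sums_Suc_iff) simp
  also have "(\<lambda>n. g (2 * Suc n) + g (Suc (2 * Suc n))) =
      (\<lambda>n. 2 powr (- s) * (of_int (eps (Suc n)) * powr_diff hs' s (real (Suc n))))"
  proof
    fix n
    define x where "x = real (Suc n)"
    have x: "x > 0" by (simp add: x_def)
    have "powr_diff hs s (2 * (x + 1 / 2)) =
        2 powr (- s) * powr_diff (map (\<lambda>h. h / 2) hs) s (x + 1 / 2)"
      by (intro powr_diff_double hs) (use x in auto)
    moreover have "2 * (x + 1 / 2) = real (Suc (2 * Suc n))" "2 * x = real (2 * Suc n)"
      by (simp_all add: x_def)
    ultimately have "g (2 * Suc n) + g (Suc (2 * Suc n)) =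
       of_int (eps (Suc n)) * (2 powr (- s) * powr_diff (map (\<lambda>h. h / 2) hs) s x) -
       of_int (eps (Suc n)) * (2 powr (- s) * powr_diff (map (\<lambda>h. h / 2) hs) s (x + 1 / 2))"
      using powr_diff_double[of x hs s, OF x hs]
      unfolding g_def eps_double eps_double_Suc by simp
    also have "\<dots> = 2 powr (- s) * (of_int (eps (Suc n)) * powr_diff hs' s x)"
      by (simp add: hs'_def algebra_simps)
    finally show "g (2 * Suc n) + g (Suc (2 * Suc n)) =
        2 powr (- s) * (of_int (eps (Suc n)) * powr_diff hs' s (real (Suc n)))"
      unfolding x_def .
  qed
  finally have "(\<lambda>n. 2 powr (- s) * (of_int (eps (Suc n)) * powr_diff hs' s (real (Suc n))))
      sums (D + powr_diff hs s 1)"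
    by (simp add: g_def eps_1)
  moreover have "(\<lambda>n. 2 powr (- s) * (of_int (eps (Suc n)) * powr_diff hs' s (real (Suc n))))
      sums (2 powr (- s) * diff_series (\<lambda>n. of_int (eps n)) hs' s)"
    using hs s by (intro sums_mult diff_series_sums norm_eps_le) (auto simp: hs'_def)
  ultimately have "D + powr_diff hs s 1 = 2 powr (- s) * diff_series (\<lambda>n. of_int (eps n)) hs' s"
    by (rule sums_unique2)
  then show ?thesis unfolding D_def hs'_def by (simp add: algebra_simps)
qed

lemma has_field_derivative_of_real_powr_0:
  "x > 0 \<Longrightarrow> ((\<lambda>s. of_real x powr (- s)) has_field_derivative - of_real (ln x)) (at (0::complex))"
  by (auto intro!: derivative_eq_intros simp: powr_def Ln_of_real)

text \<open>After two splittings the remaining series converges for Re s > -1, so its derivative at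
  0 can be taken termwise. The terms are the logarithms of the Flajolet--Martin factors, with sum
  \<open>L\<close>.\<close>

lemma thue_morse_series:
  obtains D L where "D holomorphic_on UNIV"
    "\<And>s. Re s > 1 \<Longrightarrow> D s = diff_series (\<lambda>n. of_int (eps n)) [] s"
    "(D has_field_derivative of_real (L + ln (2 / 3))) (at 0)"
    "FM_partial \<longlonglongrightarrow> exp L"
proof -
  define a :: "nat \<Rightarrow> complex" where "a = (\<lambda>n. of_int (eps n))"
  have a: "norm (a n) \<le> 1" for n unfolding a_def by (rule norm_eps_le)
  have "\<exists>hs' u v. (\<forall>h\<in>set hs'. h \<ge> 0) \<and> length hs' = Suc (length hs) \<and>
        u holomorphic_on UNIV \<and> v holomorphic_on UNIV \<and>
        (\<forall>s. Re s > 1 \<longrightarrow> diff_series a hs s = u s + v s * diff_series a hs' s)"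
    if hs: "\<And>h. h \<in> set hs \<Longrightarrow> h \<ge> 0" for hs
  proof -
    have "diff_series a hs s = - powr_diff hs s 1 + 2 powr (- s) * diff_series a (1 / 2 # map (\<lambda>h. h / 2) hs) s"
      if "Re s > 1" for s
      unfolding a_def using hs that by (intro diff_series_eps) auto
    then show ?thesis using hs
      by (intro exI[of _ "1 / 2 # map (\<lambda>h. h / 2) hs"] exI[of _ "\<lambda>s. - powr_diff hs s 1"]
            exI[of _ "\<lambda>s. 2 powr (- s)"])
         (auto intro!: holomorphic_intros)
  qed
  then obtain D where D: "D holomorphic_on UNIV" "\<And>s. Re s > 1 \<Longrightarrow> D s = diff_series a [] s"
    using diff_series_entire_continuation[of a, OF a] by blast
  \<comment> \<open>The first splitting creates the step 1/2; the second halves it to 1/4 and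
    prepends a new 1/2. The boundary terms are 1 and \<open>powr_diff [1 / 2] s 1\<close>, which is
    1 - (3/2)^(-s).\<close>
  define S where "S = diff_series a [1 / 2, 1 / 4]"
  define T where "T s = - 1 + 2 powr (- s) * (- (1 - (3 / 2) powr (- s)) + 2 powr (- s) * S s)" for s
  have S_hol: "S holomorphic_on {s. Re s > - 1}"
  proof -
    have "S holomorphic_on {s. Re s > 1 - real (length [1 / 2, 1 / 4 :: real])}"
      unfolding S_def by (intro holomorphic_diff_series a) auto
    then show ?thesis by simp
  qed
  have DT: "D s = T s" if "Re s > - 1" for s
  proof (rule halfplane_identity[where f = D and g = T and c = "- 1" and d = 1])
    show "D holomorphic_on {s. Re s > - 1}" using D(1) by (rule holomorphic_on_subset) auto
    show "T holomorphic_on {s. Re s > - 1}"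
      unfolding T_def by (intro holomorphic_intros S_hol) auto
    show "D s = T s" if "Re s > 1" for s
      using that D(2)[of s] diff_series_eps[of "[]" s] diff_series_eps[of "[1 / 2]" s]
      by (simp add: T_def S_def a_def)
  qed (use that in auto)
  define w where "w n = of_int (eps (Suc n)) * ln ((4 * real (Suc n) + 1) * (4 * real (Suc n) + 2) /
      (4 * real (Suc n) * (4 * real (Suc n) + 3)))" for n
  have der: "deriv (\<lambda>s. powr_diff [1 / 2, 1 / 4] s x) 0 =
      of_real (ln ((4 * x + 1) * (4 * x + 2) / (4 * x * (4 * x + 3))))" if x: "x > 0" for x
  proof -
    have "((\<lambda>s. powr_diff [1 / 2, 1 / 4] s x) has_field_derivative
        (- of_real (ln x) - - of_real (ln (x + 1 / 4)) -
        (- of_real (ln (x + 1 / 2)) - - of_real (ln (x + 1 / 2 + 1 / 4))))) (at 0)"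
      unfolding powr_diff.simps using x
      by (intro DERIV_diff has_field_derivative_of_real_powr_0) auto
    moreover
    \<comment> \<open>Rescaling all four arguments by 4 changes nothing, since the
      \<open>ln 4\<close> terms enter with two plus and two minus signs.\<close>
    have l: "ln ((4 * x + k) / 4) = ln (4 * x + k) - ln 4" if "k > 0" for k
      using x that by (simp add: ln_div)
    have "x + 1 / 4 = (4 * x + 1) / 4" "x + 1 / 2 = (4 * x + 2) / 4"
      "x + 1 / 2 + 1 / 4 = (4 * x + 3) / 4"
      by (simp_all add: field_simps)
    then have "ln (x + 1 / 4) = ln (4 * x + 1) - ln 4" "ln (x + 1 / 2) = ln (4 * x + 2) - ln 4"
      "ln (x + 1 / 2 + 1 / 4) = ln (4 * x + 3) - ln 4"
      by (simp_all only: l zero_less_one zero_less_numeral)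
    then have "- of_real (ln x) - - of_real (ln (x + 1 / 4)) -
        (- of_real (ln (x + 1 / 2)) - - of_real (ln (x + 1 / 2 + 1 / 4))) =
        complex_of_real (ln ((4 * x + 1) * (4 * x + 2) / (4 * x * (4 * x + 3))))"
      using x by (simp add: ln_div ln_mult)
    ultimately show ?thesis by (simp only: DERIV_imp_deriv)
  qed
  obtain S' where S': "(S has_field_derivative S') (at 0)"
    "(\<lambda>n. a (Suc n) * deriv (\<lambda>s. powr_diff [1 / 2, 1 / 4] s (real (Suc n))) 0) sums S'"
    unfolding S_def by (rule diff_series_deriv[of a "[1 / 2, 1 / 4]" 0]) (use a in auto)
  \<comment> \<open>The terms are real, so \<open>S'\<close> equals its real part.\<close>
  define L where "L = Re (S')"
  have ws: "(\<lambda>n. complex_of_real (w n)) sums S'"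
    using S'(2) by (simp only: der of_nat_0_less_iff zero_less_Suc w_def a_def of_real_mult of_real_of_int_eq)
  then have L: "w sums L"
    using sums_Re[OF ws] by (simp add: L_def)
  have SL: "(S has_field_derivative of_real L) (at 0)"
    using S'(1) sums_unique2[OF ws sums_of_real[OF L]] by simp
  have "powr_diff [1 / 2, 1 / 4] 0 x = 0" if "x > 0" for x
    by (rule powr_diff_0) (use that in auto)
  then have S0: "S 0 = 0" by (simp add: S_def diff_series_def del: powr_diff.simps)
  \<comment> \<open>The bracket in \<open>T\<close> and \<open>S\<close> itself vanish at 0, so the
    derivatives of the outer powers of 2 drop out, leaving S'(0) - ln (3/2).\<close>
  have dT: "(T has_field_derivative of_real (L + ln (2 / 3))) (at 0)"
  proof -
    have p: "((\<lambda>s. (3 / 2) powr (- s)) has_field_derivative - of_real (ln (3 / 2))) (at (0::complex))"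
      "((\<lambda>s. 2 powr (- s)) has_field_derivative - of_real (ln 2)) (at (0::complex))"
      using has_field_derivative_of_real_powr_0[of "3 / 2"] has_field_derivative_of_real_powr_0[of 2]
      by simp_all
    have "ln (2 / 3 :: real) = - ln (3 / 2)" by (simp add: ln_div)
    then show ?thesis unfolding T_def
      by (auto intro!: derivative_eq_intros p SL simp: S0)
  qed
  have "(D has_field_derivative of_real (L + ln (2 / 3))) (at 0)"
    by (rule has_field_derivative_transform_within_open[OF dT open_halfspace_Re_gt[of "- 1"]])
       (use DT in auto)
  moreover have "FM_partial = (\<lambda>N. exp (\<Sum>n<N. w n))"
  proof
    fix N
    show "FM_partial N = exp (\<Sum>n<N. w n)"
      by (induction N) (simp_all add: FM_partial_def exp_add w_def exp_eps_ln)
  qed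
  then have "FM_partial \<longlonglongrightarrow> exp L"
    using tendsto_exp[OF L[unfolded sums_def]] by simp
  ultimately show ?thesis using D that by (simp add: a_def)
qed

subsection \<open>The Riemann zeta function\<close>

text \<open>Adding the series to its own shift replaces p(n) by p(n) - p(n + 1) and doubles the
  value, up to the first term: one step of Euler's transformation.\<close>

lemma diff_series_alternating:
  assumes hs: "\<And>h. h \<in> set hs \<Longrightarrow> h \<ge> 0" and s: "Re s > 1 - real (length hs)"
  shows "diff_series (\<lambda>n. (- 1) ^ Suc n) hs s =
           powr_diff hs s 1 / 2 + 1 / 2 * diff_series (\<lambda>n. (- 1) ^ Suc n) (1 # hs) s"
proof -
  define E where "E = diff_series (\<lambda>n. (- 1) ^ Suc n) hs s"
  define p where "p n = powr_diff hs s (real (Suc n))" for n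
  have E: "(\<lambda>n. (- 1) ^ n * p n) sums E"
    using diff_series_sums[of "\<lambda>n. (- 1) ^ Suc n" hs s] hs s by (simp add: E_def p_def norm_power)
  then have "(\<lambda>n. (- 1) ^ Suc n * p (Suc n)) sums (E - p 0)"
    by (subst sums_Suc_iff) simp
  from sums_add[OF E this] have "(\<lambda>n. (- 1) ^ n * (p n - p (Suc n))) sums (2 * E - p 0)"
    by (simp add: algebra_simps)
  moreover have "(\<lambda>n. (- 1) ^ n * (p n - p (Suc n))) sums diff_series (\<lambda>n. (- 1) ^ Suc n) (1 # hs) s"
  proof -
    have "(\<lambda>n. (- 1) ^ Suc (Suc n) * powr_diff (1 # hs) s (real (Suc n))) sums
        diff_series (\<lambda>n. (- 1) ^ Suc n) (1 # hs) s"
      using hs s by (intro diff_series_sums) (auto simp: norm_power)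
    then show ?thesis by (simp add: p_def add_ac)
  qed
  ultimately have "2 * E - p 0 = diff_series (\<lambda>n. (- 1) ^ Suc n) (1 # hs) s"
    by (rule sums_unique2)
  then show ?thesis unfolding E_def p_def by (simp add: field_simps)
qed

text \<open>The partial sum of length 2N is twice the logarithm of the N-th Wallis product, plus ln
  ((2N + 2)/(2N + 1)) - ln 2. As convergence is assumed, the even partial sums determine the
  limit.\<close>

lemma alternating_log_series:
  assumes "(\<lambda>n. (- 1) ^ n * (2 * ln (real n + 2) - ln (real n + 1) - ln (real n + 3))) sums L"
  shows "L = 2 * ln (pi / 2) - ln 2"
proof -
  define P where "P N = (\<Sum>n<N. (- 1) ^ n * (2 * ln (real n + 2) - ln (real n + 1) - ln (real n + 3)))" for N
  define W where "W N = (\<Prod>k=1..N. (4 * real k ^ 2) / (4 * real k ^ 2 - 1))" for N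
  have Wpos: "W N > 0" for N
    unfolding W_def
  proof (intro prod_pos divide_pos_pos)
    fix k assume "k \<in> {1..N}"
    then have "real k ^ 2 \<ge> 1" by (simp add: one_le_power)
    then show "4 * real k ^ 2 - 1 > 0" by simp
  qed auto
  have P: "P (2 * N) = 2 * ln (W N) + ln (2 * real N + 2) - ln 2 - ln (2 * real N + 1)" for N
  proof (induction N)
    case 0
    then show ?case by (simp add: P_def W_def)
  next
    case (Suc N)
    define x where "x = real N"
    have x: "x \<ge> 0" by (simp add: x_def)
    have W: "W (Suc N) = W N * ((2 * x + 2) ^ 2 / ((2 * x + 1) * (2 * x + 3)))"
      by (simp add: W_def x_def power2_eq_square algebra_simps)
    have "ln (W (Suc N)) = ln (W N) + 2 * ln (2 * x + 2) - ln (2 * x + 1) - ln (2 * x + 3)"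
      unfolding W using x Wpos[of N] by (simp add: ln_mult ln_div ln_realpow)
    moreover have "P (2 * Suc N) = P (2 * N) + (2 * ln (2 * x + 2) - ln (2 * x + 1) - ln (2 * x + 3))
        - (2 * ln (2 * x + 3) - ln (2 * x + 2) - ln (2 * x + 4))"
      by (simp add: P_def x_def add_ac)
    ultimately show ?case using Suc.IH by (simp add: x_def[symmetric] add_ac algebra_simps)
  qed
  have "(\<lambda>N. ln (W N)) \<longlonglongrightarrow> ln (pi / 2)"
    using wallis unfolding W_def by (intro tendsto_ln) auto
  moreover have "(\<lambda>N. ln (2 * real N + 2) - ln (2 * real N + 1)) \<longlonglongrightarrow> 0"
    by real_asymp
  ultimately have "(\<lambda>N. 2 * ln (W N) + (ln (2 * real N + 2) - ln (2 * real N + 1)) - ln 2)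
      \<longlonglongrightarrow> 2 * ln (pi / 2) + 0 - ln 2"
    by (intro tendsto_diff tendsto_add tendsto_mult tendsto_const)
  then have "(\<lambda>N. P (2 * N)) \<longlonglongrightarrow> 2 * ln (pi / 2) - ln 2"
    unfolding P by (simp add: algebra_simps)
  moreover have "(\<lambda>N. P (2 * N)) \<longlonglongrightarrow> L"
    using assms unfolding sums_def P_def[symmetric]
    by (rule filterlim_compose) (simp add: filterlim_at_top_mult_tendsto_pos mult_nat_left_at_top)
  ultimately show ?thesis by (metis LIMSEQ_unique)
qed

lemma alternating_zeta_series:
  obtains H where "H holomorphic_on UNIV"
    "\<And>s. Re s > 1 \<Longrightarrow> H s = diff_series (\<lambda>n. (- 1) ^ Suc n) [] s"
    "H 0 = 1 / 2" "(H has_field_derivative of_real (ln (pi / 2) / 2)) (at 0)"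
proof -
  define a :: "nat \<Rightarrow> complex" where "a = (\<lambda>n. (- 1) ^ Suc n)"
  have a: "norm (a n) \<le> 1" for n by (simp add: a_def norm_power)
  have "\<exists>hs' u v. (\<forall>h\<in>set hs'. h \<ge> 0) \<and> length hs' = Suc (length hs) \<and>
        u holomorphic_on UNIV \<and> v holomorphic_on UNIV \<and>
        (\<forall>s. Re s > 1 \<longrightarrow> diff_series a hs s = u s + v s * diff_series a hs' s)"
    if hs: "\<And>h. h \<in> set hs \<Longrightarrow> h \<ge> 0" for hs
  proof -
    have "diff_series a hs s = powr_diff hs s 1 / 2 + 1 / 2 * diff_series a (1 # hs) s"
      if "Re s > 1" for s
      unfolding a_def using hs that by (intro diff_series_alternating) auto
    then show ?thesis using hs
      by (intro exI[of _ "1 # hs"] exI[of _ "\<lambda>s. powr_diff hs s 1 / 2"] exI[of _ "\<lambda>s. 1 / 2"])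
         (auto intro!: holomorphic_intros)
  qed
  then obtain H where H: "H holomorphic_on UNIV" "\<And>s. Re s > 1 \<Longrightarrow> H s = diff_series a [] s"
    using diff_series_entire_continuation[of a, OF a] by blast
  \<comment> \<open>Two averaging steps reach Re s > -1; the second boundary term is
    \<open>powr_diff [1] s 1\<close>, which is 1 - 2^(-s).\<close>
  define S where "S = diff_series a [1, 1]"
  define T where "T s = 1 / 2 + 1 / 2 * ((1 - 2 powr (- s)) / 2 + 1 / 2 * S s)" for s
  have S_hol: "S holomorphic_on {s. Re s > - 1}"
  proof -
    have "S holomorphic_on {s. Re s > 1 - real (length [1, 1 :: real])}"
      unfolding S_def by (intro holomorphic_diff_series a) auto
    then show ?thesis by simp
  qed
  have HT: "H s = T s" if "Re s > - 1" for s
  proof (rule halfplane_identity[where f = H and g = T and c = "- 1" and d = 1])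
    show "H holomorphic_on {s. Re s > - 1}" using H(1) by (rule holomorphic_on_subset) auto
    show "T holomorphic_on {s. Re s > - 1}"
      unfolding T_def by (intro holomorphic_intros S_hol) auto
    show "H s = T s" if "Re s > 1" for s
      using that H(2)[of s] diff_series_alternating[of "[]" s] diff_series_alternating[of "[1]" s]
      by (simp add: T_def S_def a_def)
  qed (use that in auto)
  have der: "deriv (\<lambda>s. powr_diff [1, 1] s x) 0 =
      of_real (2 * ln (x + 1) - ln x - ln (x + 2))" if x: "x > 0" for x
  proof -
    have "((\<lambda>s. powr_diff [1, 1] s x) has_field_derivative
        (- of_real (ln x) - - of_real (ln (x + 1)) -
        (- of_real (ln (x + 1)) - - of_real (ln (x + 1 + 1))))) (at 0)"
      unfolding powr_diff.simps using x
      by (intro DERIV_diff has_field_derivative_of_real_powr_0) auto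
    also have "- of_real (ln x) - - of_real (ln (x + 1)) - (- of_real (ln (x + 1)) - - of_real (ln (x + 1 + 1)))
        = complex_of_real (2 * ln (x + 1) - ln x - ln (x + 2))"
      by (simp add: add.assoc)
    finally show ?thesis by (rule DERIV_imp_deriv)
  qed
  obtain S' where S': "(S has_field_derivative S') (at 0)"
    "(\<lambda>n. a (Suc n) * deriv (\<lambda>s. powr_diff [1, 1] s (real (Suc n))) 0) sums S'"
    unfolding S_def by (rule diff_series_deriv[of a "[1, 1]" 0]) (use a in auto)
  define L where "L = Re (S')"
  have ws: "(\<lambda>n. complex_of_real ((- 1) ^ n * (2 * ln (real n + 2) - ln (real n + 1) - ln (real n + 3)))) sums S'"
  proof -
    have "(\<lambda>n. a (Suc n) * of_real (2 * ln (real (Suc n) + 1) - ln (real (Suc n)) - ln (real (Suc n) + 2))) sums S'"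
      using S'(2) by (simp only: der of_nat_0_less_iff zero_less_Suc)
    then show ?thesis by (simp add: a_def add_ac)
  qed
  then have Ls: "(\<lambda>n. (- 1) ^ n * (2 * ln (real n + 2) - ln (real n + 1) - ln (real n + 3))) sums L"
    unfolding L_def using sums_Re[OF ws] by (simp only: Re_complex_of_real)
  note L = alternating_log_series[OF Ls]
  have SL: "(S has_field_derivative of_real L) (at 0)"
    using S'(1) sums_unique2[OF ws sums_of_real[OF Ls]] by simp
  have "powr_diff [1, 1] 0 x = 0" if "x > 0" for x
    by (rule powr_diff_0) (use that in auto)
  then have S0: "S 0 = 0" by (simp add: S_def diff_series_def del: powr_diff.simps)
  \<comment> \<open>The value is (ln 2 + L) / 4, and the ln 2 cancels against the one in
    \<open>L\<close>.\<close>
  have dT: "(T has_field_derivative of_real (ln (pi / 2) / 2)) (at 0)"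
  proof -
    have p: "((\<lambda>s. 2 powr (- s)) has_field_derivative - of_real (ln 2)) (at (0::complex))"
      using has_field_derivative_of_real_powr_0[of 2] by simp
    show ?thesis unfolding T_def
      by (auto intro!: derivative_eq_intros p SL simp: L field_simps)
  qed
  have "(H has_field_derivative of_real (ln (pi / 2) / 2)) (at 0)"
    by (rule has_field_derivative_transform_within_open[OF dT open_halfspace_Re_gt[of "- 1"]])
       (use HT in auto)
  moreover have "H 0 = 1 / 2" by (simp add: HT T_def S0)
  ultimately show ?thesis using H that by (simp add: a_def)
qed

section \<open>The zeta and eta series for Re s > 1\<close>

text \<open>Since \<open>0 powr z = 0\<close>, a term at n = 0 may be added freely, which suits both
  grouping into pairs and sums over all naturals.\<close>

lemma diff_series_Nil_sums:
  assumes "\<And>n. norm (a n) \<le> 1" "Re s > 1"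
  shows "(\<lambda>n. a n * of_nat n powr (- s)) sums diff_series a [] s"
proof -
  have "(\<lambda>n. a (Suc n) * powr_diff [] s (real (Suc n))) sums diff_series a [] s"
    by (rule diff_series_sums) (use assms in auto)
  then have "(\<lambda>n. a (Suc n) * of_nat (Suc n) powr (- s)) sums diff_series a [] s"
    by simp
  then show ?thesis
    unfolding sums_Suc_iff[of "\<lambda>n. a n * of_nat n powr (- s)"] by simp
qed

lemma diff_series_Nil_has_sum:
  assumes "\<And>n. norm (a n) \<le> 1" "Re s > 1"
  shows "((\<lambda>n. a n * of_nat n powr (- s)) has_sum diff_series a [] s) UNIV"
proof (rule norm_summable_imp_has_sum)
  have "summable (\<lambda>n. norm (a (Suc n) * powr_diff [] s (real (Suc n))))"
    by (rule summable_norm_diff_series) (use assms in auto)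
  then have "summable (\<lambda>n. norm (a (Suc n) * of_nat (Suc n) powr (- s)))"
    by simp
  then show "summable (\<lambda>n. norm (a n * of_nat n powr (- s)))"
    unfolding summable_Suc_iff[of "\<lambda>n. norm (a n * of_nat n powr (- s))"] .
qed (rule diff_series_Nil_sums[OF assms])

text \<open>Subtracting the alternating series cancels the odd terms and doubles the even ones,
  leaving 2 * 2^(-s) times the zeta series.\<close>

lemma zeta_alternating_zeta:
  assumes "Re s > 1"
  shows "diff_series (\<lambda>n. 1) [] s * (1 - 2 powr (1 - s)) = diff_series (\<lambda>n. (- 1) ^ Suc n) [] s"
proof -
  define Z where "Z = diff_series (\<lambda>n. 1) [] s"
  define E where "E = diff_series (\<lambda>n. (- 1) ^ Suc n) [] s"
  define f :: "nat \<Rightarrow> complex" where "f n = of_nat n powr (- s)" for n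
  have Z: "f sums Z"
    using diff_series_Nil_sums[of "\<lambda>n. 1" s] assms by (simp add: f_def[abs_def] Z_def)
  have E: "(\<lambda>n. (- 1) ^ Suc n * f n) sums E"
    unfolding f_def E_def by (rule diff_series_Nil_sums) (use assms in \<open>auto simp: norm_power\<close>)
  define g where "g n = f n - (- 1) ^ Suc n * f n" for n
  have "g sums (Z - E)" unfolding g_def by (rule sums_diff[OF Z E])
  then have "(\<lambda>n. sum g {n * 2..<n * 2 + 2}) sums (Z - E)"
    by (rule sums_group) simp
  moreover have "sum g {n * 2..<n * 2 + 2} = 2 powr (1 - s) * f n" for n
  proof -
    have "{n * 2..<n * 2 + 2} = {2 * n, Suc (2 * n)}" by auto
    then have "sum g {n * 2..<n * 2 + 2} = g (2 * n) + g (Suc (2 * n))" by simp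
    also have "\<dots> = 2 * f (2 * n)" by (simp add: g_def)
    also have "f (2 * n) = 2 powr (- s) * f n"
      using powr_times_real[of 2 "of_nat n" "- s"] by (simp add: f_def)
    also have "2 * (2 powr (- s) * f n) = 2 powr (1 - s) * f n"
      using powr_add[of "2::complex" 1 "- s"] by (simp add: algebra_simps)
    finally show ?thesis .
  qed
  ultimately have "(\<lambda>n. 2 powr (1 - s) * f n) sums (Z - E)" by simp
  moreover have "(\<lambda>n. 2 powr (1 - s) * f n) sums (2 powr (1 - s) * Z)"
    by (intro sums_mult Z)
  ultimately have "Z - E = 2 powr (1 - s) * Z" by (rule sums_unique2)
  then show ?thesis unfolding Z_def E_def by (simp add: algebra_simps)
qed

lemma two_powr_neq_1:
  assumes "Re s > 1"
  shows "1 - 2 powr (1 - s) \<noteq> (0 :: complex)"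
proof
  assume "1 - 2 powr (1 - s) = 0"
  then have "norm (2 powr (1 - s)) = 1" by simp
  moreover have "norm (2 powr (1 - s)) = 2 powr (1 - Re s)"
    using norm_powr_real_powr[of 2 "1 - s"] by simp
  ultimately show False using assms powr_less_mono[of "1 - Re s" 0 "2::real"] by simp
qed

subsection \<open>The regularized products\<close>

text \<open>For signs c and \<epsilon>_n, the number (1 + c \<epsilon>_n) / 2 is the indicator of
  \<epsilon>_n = c, so one combination of zeta and D handles both sets.\<close>

lemma zeta_continuation_eps_eq:
  fixes c :: int
  assumes c: "c = 1 \<or> c = - 1"
    and D: "D holomorphic_on UNIV" "\<And>s. Re s > 1 \<Longrightarrow> D s = diff_series (\<lambda>n. of_int (eps n)) [] s"
    and D': "(D has_field_derivative d) (at 0)"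
  obtains Z where "zeta_continuation {n. n \<ge> 1 \<and> eps n = c} real Z" "\<not> is_pole Z 0"
    "deriv Z 0 = (- of_real (ln (2 * pi)) / 2 + of_int c * d) / 2"
proof -
  obtain H where H: "H holomorphic_on UNIV"
    "\<And>s. Re s > 1 \<Longrightarrow> H s = diff_series (\<lambda>n. (- 1) ^ Suc n) [] s"
    "H 0 = 1 / 2" "(H has_field_derivative of_real (ln (pi / 2) / 2)) (at 0)"
    using alternating_zeta_series by blast
  define F where "F s = (H s / (1 - 2 powr (1 - s)) + of_int c * D s) / 2" for s
  have an: "F analytic_on {s}" if "1 - 2 powr (1 - s) \<noteq> 0" for s
    unfolding F_def using that H(1) D(1)
    by (intro analytic_intros) (auto simp: analytic_on_holomorphic intro: holomorphic_on_subset)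
  have mero: "F meromorphic_on UNIV"
  proof -
    have "(\<lambda>s. 1 - 2 powr (1 - s)) analytic_on (UNIV :: complex set)"
      by (auto simp: analytic_on_holomorphic intro!: holomorphic_intros exI[of _ UNIV])
    moreover have "H analytic_on UNIV" "D analytic_on UNIV"
      using H(1) D(1) by (auto simp: analytic_on_open)
    ultimately show ?thesis unfolding F_def
      by (intro meromorphic_intros analytic_on_imp_meromorphic_on) auto
  qed
  have an0: "F analytic_on {0}" by (rule an) simp
  \<comment> \<open>At zeros of the denominator, division by zero gives \<open>F\<close> an
    arbitrary value; \<open>remove_sings\<close> repairs this and leaves \<open>F\<close> unchanged
    for Re s > 1 and at 0, where it is analytic.\<close>
  have sum: "((\<lambda>n. complex_of_real (real n) powr (- s)) has_sum remove_sings F s) {n. n \<ge> 1 \<and> eps n = c}"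
    if s: "Re s > 1" for s
  proof -
    have "((\<lambda>n. (1 * of_nat n powr (- s) + of_int c * (of_int (eps n) * of_nat n powr (- s))) * (1 / 2))
       has_sum (diff_series (\<lambda>n. 1) [] s + of_int c * diff_series (\<lambda>n. of_int (eps n)) [] s) * (1 / 2)) UNIV"
      using s norm_eps_le
      by (intro has_sum_cmult_left has_sum_add has_sum_cmult_right diff_series_Nil_has_sum) auto
    moreover have "diff_series (\<lambda>n. 1) [] s = H s / (1 - 2 powr (1 - s))"
      using zeta_alternating_zeta[OF s] two_powr_neq_1[OF s] H(2)[OF s] by (simp add: field_simps)
    ultimately have "((\<lambda>n. (1 * of_nat n powr (- s) + of_int c * (of_int (eps n) * of_nat n powr (- s))) * (1 / 2))
       has_sum F s) UNIV"
      by (simp only: F_def D(2)[OF s] times_divide_eq_right mult_1_right)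
    \<comment> \<open>Outside the set either n = 0, where the powers are 0 by convention, or
      \<epsilon>_n = -c, where the two summands cancel.\<close>
    also have "?this \<longleftrightarrow> ((\<lambda>n. complex_of_real (real n) powr (- s)) has_sum F s) {n. n \<ge> 1 \<and> eps n = c}"
    proof (rule has_sum_cong_neutral)
      fix n assume "n \<in> UNIV - {n. n \<ge> 1 \<and> eps n = c}"
      then show "(1 * of_nat n powr (- s) + of_int c * (of_int (eps n) * of_nat n powr (- s))) * (1 / 2) = 0"
        using eps_cases[of n] c by (cases "n = 0") auto
    qed (use c in auto)
    finally show ?thesis using an[OF two_powr_neq_1[OF s]] by simp
  qed
  show ?thesis
  proof (rule that[of "remove_sings F"])
    show "zeta_continuation {n. n \<ge> 1 \<and> eps n = c} real (remove_sings F)"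
      unfolding zeta_continuation_def using sum remove_sings_nicely_meromorphic[OF mero] by blast
    have "remove_sings F analytic_on {0}" using an0 by (rule remove_sings_analytic_on)
    then show "\<not> is_pole (remove_sings F) 0"
      using analytic_at_imp_no_pole by blast
    have p: "((\<lambda>s. 2 powr (1 - s)) has_field_derivative - (2 * of_real (ln 2))) (at (0::complex))"
    proof -
      have "((\<lambda>s. 2 powr (1 - s)) has_field_derivative - (2 powr (1 - 0) * Ln 2)) (at (0::complex))"
        by (auto intro!: derivative_eq_intros simp: powr_def)
      then show ?thesis using Ln_of_real[of 2] by simp
    qed
    \<comment> \<open>At 0 the denominator is -1 with derivative 2 ln 2, so with eta(0) = 1/2 the
      quotient rule gives zeta'(0) = -ln (\<pi>/2) / 2 - ln 2.\<close>
    have "(F has_field_derivative (- of_real (ln (2 * pi)) / 2 + of_int c * d) / 2) (at 0)"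
      unfolding F_def
      by (auto intro!: derivative_eq_intros p H(4) D' simp: H(3) ln_mult ln_div field_simps)
    then show "deriv (remove_sings F) 0 = (- of_real (ln (2 * pi)) / 2 + of_int c * d) / 2"
      using an0 by (simp add: DERIV_imp_deriv)
  qed
qed

section \<open>The product Q and the Flajolet--Martin product\<close>

text \<open>The factors of Q at 2n and 2n + 1 have opposite exponents and combine to the inverse of
  the n-th Flajolet--Martin factor. The unpaired factor at 1 is (2/3)^(-1).\<close>

lemma Q_partial_odd: "Q_partial (Suc (2 * N)) = 3 / 2 / FM_partial N"
proof (induction N)
  case 0
  then show ?case by (simp add: Q_partial_def FM_partial_def eps_1)
next
  case (Suc N)
  define x where "x = real (Suc N)"
  have x: "x > 0" by (simp add: x_def)
  have "Q_partial (Suc (2 * Suc N)) = Q_partial (Suc (2 * N)) *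
      (2 * real (2 * Suc N) / (2 * real (2 * Suc N) + 1)) powi eps (2 * Suc N) *
      (2 * real (Suc (2 * Suc N)) / (2 * real (Suc (2 * Suc N)) + 1)) powi eps (Suc (2 * Suc N))"
    by (simp add: Q_partial_def)
  also have "\<dots> = Q_partial (Suc (2 * N)) * (4 * x / (4 * x + 1)) powi eps (Suc N) *
      ((4 * x + 2) / (4 * x + 3)) powi (- eps (Suc N))"
    unfolding eps_double eps_double_Suc by (simp add: x_def algebra_simps)
  also have "\<dots> = Q_partial (Suc (2 * N)) /
      ((4 * x + 1) * (4 * x + 2) / (4 * x * (4 * x + 3))) powi eps (Suc N)"
    using eps_cases[of "Suc N"] x by (auto simp: power_int_minus divide_simps)
  also have "\<dots> = 3 / 2 / FM_partial (Suc N)"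
    unfolding Suc.IH by (simp add: FM_partial_def x_def)
  finally show ?case .
qed

lemma Q_partial_tendsto:
  assumes "FM_partial \<longlonglongrightarrow> l" "l \<noteq> 0"
  shows "Q_partial \<longlonglongrightarrow> 3 / 2 / l"
proof -
  define q where "q n = 2 * real n / (2 * real n + 1)" for n
  \<comment> \<open>This is 1 at odd n and the unpaired last factor of \<open>Q_partial n\<close> at
    even n > 0. It tends to 1 because ln (q n) tends to 0 and its coefficients are bounded by 1 in
    absolute value.\<close>
  define r where "r n = exp (of_int (if odd n then 0 else eps n) * ln (q n))" for n
  have "(\<lambda>n. ln (q n)) \<longlonglongrightarrow> 0" unfolding q_def by real_asymp
  then have "(\<lambda>n. of_int (if odd n then 0 else eps n) * ln (q n)) \<longlonglongrightarrow> 0"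
  proof (rule Lim_null_comparison[rotated, OF tendsto_rabs_zero])
    show "\<forall>\<^sub>F n in sequentially. norm (of_int (if odd n then 0 else eps n) * ln (q n)) \<le> \<bar>ln (q n)\<bar>"
    proof (intro always_eventually allI)
      fix n
      show "norm (of_int (if odd n then 0 else eps n) * ln (q n)) \<le> \<bar>ln (q n)\<bar>"
        using eps_cases[of n] by auto
    qed
  qed
  then have "r \<longlonglongrightarrow> exp 0" unfolding r_def by (rule tendsto_exp)
  moreover have "(\<lambda>n. FM_partial ((n - 1) div 2)) \<longlonglongrightarrow> l"
    by (rule filterlim_compose[OF assms(1)]) real_asymp
  ultimately have "(\<lambda>n. 3 / 2 / FM_partial ((n - 1) div 2) * r n) \<longlonglongrightarrow> 3 / 2 / l * exp 0"
    using assms(2) by (intro tendsto_intros)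
  moreover have "\<forall>\<^sub>F n in sequentially. 3 / 2 / FM_partial ((n - 1) div 2) * r n = Q_partial n"
    using eventually_gt_at_top[of 0]
  proof eventually_elim
    case (elim n)
    show ?case
    proof (cases "odd n")
      case True
      then obtain m where "n = Suc (2 * m)" by (auto elim: oddE)
      then show ?thesis by (simp add: r_def Q_partial_odd)
    next
      case False
      with elim obtain m where m: "n = Suc (Suc (2 * m))"
        by (metis Suc_pred even_Suc oddE Suc_eq_plus1)
      have "q n > 0" using elim by (simp add: q_def)
      then have "r n = q n powi eps n" using False by (simp add: r_def exp_eps_ln)
      moreover have "Q_partial n = Q_partial (Suc (2 * m)) * q n powi eps n"
        unfolding m by (simp add: Q_partial_def q_def)
      ultimately show ?thesis using m by (simp add: Q_partial_odd)
    qed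
  qed
  ultimately have "Q_partial \<longlonglongrightarrow> 3 / 2 / l * exp 0"
    by (rule Lim_transform_eventually)
  then show ?thesis by simp
qed

theorem theorem1:
  shows "convergent Q_partial \<and> convergent FM_partial \<and>
    zeta_regularizable odious real \<and>
    zeta_regularizable evil real \<and>
    zeta_reg_prod odious real = complex_of_real ((2 * pi) powr (1 / 4) * Q powr (- 1 / 2)) \<and>
    zeta_reg_prod evil real = complex_of_real ((2 * pi) powr (1 / 4) * Q powr (1 / 2)) \<and>
    Q = 2 powr (- 1 / 2) * exp euler_mascheroni / flajolet_martin \<and>
    zeta_reg_prod odious real =
      complex_of_real (pi powr (1 / 4) * sqrt (2 * flajolet_martin * exp (- euler_mascheroni)))"
proof -
  obtain D L where D: "D holomorphic_on UNIV"
    "\<And>s. Re s > 1 \<Longrightarrow> D s = diff_series (\<lambda>n. of_int (eps n)) [] s"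
    "(D has_field_derivative of_real (L + ln (2 / 3))) (at 0)"
    and FM: "FM_partial \<longlonglongrightarrow> exp L"
    using thue_morse_series by blast
  have Qlim: "Q_partial \<longlonglongrightarrow> 3 / 2 / exp L"
    using FM by (rule Q_partial_tendsto) simp
  have Q: "Q = 3 / 2 / exp L" unfolding Q_def by (rule limI[OF Qlim])
  have Qpos: "Q > 0" by (simp add: Q)
  \<comment> \<open>The left side is D'(0).\<close>
  have lnQ: "L + ln (2 / 3) = - ln Q" by (simp add: Q ln_div ln_mult)
  have fm: "flajolet_martin = 2 powr (- 1 / 2) * exp euler_mascheroni * (2 / 3) * exp L"
    unfolding flajolet_martin_def limI[OF FM] ..
  have Q_fm: "Q = 2 powr (- 1 / 2) * exp euler_mascheroni / flajolet_martin"
    unfolding fm Q by simp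
  have odious: "odious = {n. n \<ge> 1 \<and> eps n = - 1}"
    by (auto simp: odious_def eps_def minus_one_power_iff)
  have evil: "evil = {n. n \<ge> 1 \<and> eps n = 1}"
    by (auto simp: evil_def eps_def minus_one_power_iff split: if_splits)
  have prod: "zeta_regularizable {n. n \<ge> 1 \<and> eps n = c} real \<and>
      zeta_reg_prod {n. n \<ge> 1 \<and> eps n = c} real =
        complex_of_real ((2 * pi) powr (1 / 4) * Q powr (of_int c / 2))" if c: "c = 1 \<or> c = - 1" for c
  proof -
    obtain Z where Z: "zeta_continuation {n. n \<ge> 1 \<and> eps n = c} real Z" "\<not> is_pole Z 0"
      "deriv Z 0 = (- of_real (ln (2 * pi)) / 2 + of_int c * of_real (L + ln (2 / 3))) / 2"
      using zeta_continuation_eps_eq[OF c D] by blast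
    have "- deriv Z 0 = of_real (ln (2 * pi) / 4 + of_int c / 2 * ln Q)"
      unfolding Z(3) lnQ by (simp add: field_simps)
    then have "exp (- deriv Z 0) = of_real (exp (ln (2 * pi) / 4 + of_int c / 2 * ln Q))"
      by (simp only: exp_of_real)
    also have "exp (ln (2 * pi) / 4 + of_int c / 2 * ln Q) = (2 * pi) powr (1 / 4) * Q powr (of_int c / 2)"
      using Qpos by (simp add: powr_def exp_add)
    finally show ?thesis
      using Z(1,2) zeta_reg_prod_eqI[OF Z(1)] by (auto simp: zeta_regularizable_def)
  qed
  have "(2 * pi) powr (1 / 4) * Q powr (- 1 / 2) =
      pi powr (1 / 4) * sqrt (2 * flajolet_martin * exp (- euler_mascheroni))"
  proof -
    have pos: "flajolet_martin > 0" by (simp add: fm)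
    \<comment> \<open>The factor 2^(-1/2) of Q yields 2^(1/4) here; with the 2^(1/4) from
      (2\<pi>)^(1/4) it makes up the \<surd>2 on the right.\<close>
    have "Q powr (- 1 / 2) = exp (- ln Q / 2)" using Qpos by (simp add: powr_def)
    also have "- ln Q = ln 2 / 2 - euler_mascheroni + ln flajolet_martin"
      unfolding Q_fm using pos by (simp add: ln_mult ln_div ln_powr)
    finally have 1: "Q powr (- 1 / 2) = exp ((ln 2 / 2 - euler_mascheroni + ln flajolet_martin) / 2)" .
    have 2: "sqrt (2 * flajolet_martin * exp (- euler_mascheroni)) =
        exp ((ln 2 + ln flajolet_martin - euler_mascheroni) / 2)"
    proof -
      have "sqrt (2 * flajolet_martin * exp (- euler_mascheroni)) =
          exp (ln (2 * flajolet_martin * exp (- euler_mascheroni)) / 2)"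
        using pos by (simp add: powr_half_sqrt[symmetric] powr_def)
      then show ?thesis using pos by (simp add: ln_mult)
    qed
    have 3: "(2 * pi) powr (1 / 4) = exp ((ln 2 + ln pi) / 4)" "pi powr (1 / 4) = exp (ln pi / 4)"
      by (simp_all add: powr_def ln_mult)
    show ?thesis unfolding 1 2 3 exp_add[symmetric] by (simp add: field_simps)
  qed
  then show ?thesis
    using prod[of 1] prod[of "- 1"] Qlim FM Q_fm by (auto simp: odious evil convergent_def)
qed

end
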